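(* Let $p$ be a prime with $p-1=2^iq_1^{j_1}q_2^{j_2}$, where $q_1\neq q_2$ are odd primes and $i,j_1,j_2\ge 1$. For any generators $g_1,g_2$ of $\mathbb{Z}_p^*$, exactly one of the following holds: $\mathcal{NI}(g_1)\cap\mathcal{NI}(g_2)=\emptyset$, or $\mathcal{NI}(g_1)=\mathcal{NI}(g_2)$.
   Context: $\mathcal{G}$ is the set of generators of $\mathbb{Z}_p^*$, $\mathcal{R}$ the set of quadratic residues in $\mathbb{Z}_p^*$, $\mathcal{NG}$ the set of quadratic non-residues that are not generators. For $g\in\mathcal{G}$: $\bar{\mathcal{R}}_g=\{r\in\mathcal{R}: gr\in\mathcal{NG}\}$ and $\mathcal{NI}(g)=\bar{\mathcal{R}}_g\cap\bar{\mathcal{R}}_{g^{-1}}$ (products mod $p$). *)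

theory Defs
  imports "HOL-Number_Theory.Residues" "HOL-Algebra.Generated_Groups"
begin

(* Elements of the unit group are represented by their residues in {1..p - 1}, as integers. *)
definition Zstar :: "nat \<Rightarrow> int monoid" where
  "Zstar p = units_of (residue_ring (int p))"

definition gens :: "nat \<Rightarrow> int set" where
  "gens p = {g \<in> carrier (Zstar p). generate (Zstar p) {g} = carrier (Zstar p)}"

(* QuadRes also accepts 0; only units are considered here. *)
definition quad_res :: "nat \<Rightarrow> int set" where
  "quad_res p = {r \<in> carrier (Zstar p). QuadRes (int p) r}"

definition nonres_nongens :: "nat \<Rightarrow> int set" where
  "nonres_nongens p = (carrier (Zstar p) - quad_res p) - gens p"

definition Rbar :: "nat \<Rightarrow> int \<Rightarrow> int set" where
  "Rbar p g = {r \<in> quad_res p. g \<otimes>\<^bsub>Zstar p\<^esub> r \<in> nonres_nongens p}"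

definition NI :: "nat \<Rightarrow> int \<Rightarrow> int set" where
  "NI p g = Rbar p g \<inter> Rbar p (inv\<^bsub>Zstar p\<^esub> g)"

end

theory Submission
  imports Defs
begin

text \<open>Fix a generator \<open>g\<close> and write units as powers \<open>g\<^sup>k\<close>, with \<open>k\<close> modulo \<open>p - 1\<close>. Since \<open>a\<close> is
  coprime to \<open>p - 1\<close>, the element \<open>g\<^sup>k\<close> lies in \<open>NI(g\<^sup>a)\<close> iff \<open>k\<close> is even and for one of the two
  orderings \<open>(q, r)\<close> of the odd prime divisors of \<open>p - 1\<close> we have \<open>k \<equiv> a\<close> modulo \<open>q\<close> and
  \<open>k \<equiv> -a\<close> modulo \<open>r\<close>. If \<open>k\<close> satisfies this for both \<open>a\<close> and \<open>b\<close>, then \<open>a \<equiv> b\<close> modulo both \<open>q\<close>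
  and \<open>r\<close>, or \<open>a \<equiv> -b\<close> modulo both, and in either case the conditions for \<open>a\<close> and \<open>b\<close> coincide.
  By the Chinese remainder theorem such \<open>k\<close> exist, so the two alternatives exclude each other.\<close>

section \<open>Sign patterns of exponents modulo two odd primes\<close>

definition opposite_cong :: "int \<Rightarrow> int \<Rightarrow> int \<Rightarrow> int \<Rightarrow> bool" where
  "opposite_cong q r a k \<longleftrightarrow> q dvd k + a \<and> r dvd k - a \<or> q dvd k - a \<and> r dvd k + a"

text \<open>Each hypothesis uses opposite signs at \<open>q\<close> and \<open>r\<close>, so the two
  sign patterns agree at both primes or differ at both; eliminating \<open>k\<close> at each prime
  leaves \<open>a - b\<close> or \<open>a + b\<close>.\<close>

lemma opposite_cong_common:
  assumes "opposite_cong q r a k" and "opposite_cong q r b k"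
  shows "q dvd a - b \<and> r dvd a - b \<or> q dvd a + b \<and> r dvd a + b"
proof -
  have *: "(d dvd k + a \<and> d dvd k + b \<longrightarrow> d dvd a - b) \<and> (d dvd k - a \<and> d dvd k - b \<longrightarrow> d dvd a - b) \<and>
    (d dvd k + a \<and> d dvd k - b \<longrightarrow> d dvd a + b) \<and> (d dvd k - a \<and> d dvd k + b \<longrightarrow> d dvd a + b)" for d
    using dvd_diff[of d "k + a" "k + b"] dvd_diff[of d "k - b" "k - a"]
      dvd_diff[of d "k + a" "k - b"] dvd_diff[of d "k + b" "k - a"]
    by (simp add: algebra_simps)
  show ?thesis
    using assms *[of q] *[of r] unfolding opposite_cong_def by blast
qed

text \<open>If \<open>a\<close> and \<open>b\<close> are congruent, every divisibility is preserved;
  if they are negatives of each other, the two disjuncts of \<open>opposite_cong\<close>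
  swap.\<close>

lemma opposite_cong_transfer:
  assumes "q dvd a - b \<and> r dvd a - b \<or> q dvd a + b \<and> r dvd a + b"
  shows "opposite_cong q r a k \<longleftrightarrow> opposite_cong q r b k"
proof -
  have minus: "(d dvd k + a \<longleftrightarrow> d dvd k + b) \<and> (d dvd k - a \<longleftrightarrow> d dvd k - b)" if "d dvd a - b" for d
    using dvd_add_right_iff[OF that, of "k + b"] dvd_add_right_iff[OF that, of "k - a"]
    by (simp add: algebra_simps)
  have plus: "(d dvd k + a \<longleftrightarrow> d dvd k - b) \<and> (d dvd k - a \<longleftrightarrow> d dvd k + b)" if "d dvd a + b" for d
    using dvd_add_right_iff[OF that, of "k - b"] dvd_add_right_iff[OF that, of "k - a"]
    by (simp add: algebra_simps)
  show ?thesis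
    using assms minus[of q] minus[of r] plus[of q] plus[of r] unfolding opposite_cong_def by blast
qed

lemma odd_coprime_dvd_add_diff:
  fixes q a k :: int
  assumes "odd q" and "coprime a q" and "q dvd k + a" and "q dvd k - a"
  shows "is_unit q"
proof -
  have "q dvd 2 * a"
    using dvd_diff[OF assms(3,4)] by simp
  moreover have "coprime q 2"
    using assms(1) by simp
  ultimately have "q dvd a"
    by (simp add: coprime_dvd_mult_right_iff)
  then show ?thesis
    using assms(2) by (simp add: coprime_absorb_right)
qed

text \<open>Distributing gives four cases. A single prime dividing both \<open>k + a\<close> and
  \<open>k - a\<close> would be a unit by \<open>odd_coprime_dvd_add_diff\<close>, so only the two
  mixed cases remain.\<close>

lemma opposite_cong_iff:
  fixes q r a k :: int
  assumes "prime q" "prime r" "odd q" "odd r" "coprime a q" "coprime a r"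
  shows "(q dvd k + a \<or> r dvd k + a) \<and> (q dvd k - a \<or> r dvd k - a) \<longleftrightarrow> opposite_cong q r a k"
  using assms odd_coprime_dvd_add_diff[of q a k] odd_coprime_dvd_add_diff[of r a k]
  unfolding opposite_cong_def by auto

lemma ex_even_opposite_cong:
  fixes q r a :: int
  assumes "coprime q r" "odd q" "odd r"
  shows "\<exists>k. even k \<and> opposite_cong q r a k"
proof -
  obtain y where y: "[y = a] (mod q)" "[y = - a] (mod r)"
    using binary_chinese_remainder_int[OF assms(1)] by blast
  \<comment> \<open>A second Chinese remainder step forces evenness; \<open>2\<close> is coprime to
    \<open>q * r\<close> as both factors are odd.\<close>
  obtain k where k: "[k = 0] (mod 2)" "[k = y] (mod q * r)"
    using binary_chinese_remainder_int[of 2 "q * r"] assms(2,3) by auto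
  have "[k = a] (mod q)" "[k = - a] (mod r)"
    using k(2) y by (meson cong_dvd_modulus dvd_triv_left dvd_triv_right cong_trans)+
  then show ?thesis
    using k(1) unfolding opposite_cong_def by (auto simp: cong_iff_dvd_diff)
qed

lemma odd_coprime_iff_not_dvd:
  fixes q r m :: int
  assumes "prime q" "prime r" "odd m" "s \<ge> 1" "t \<ge> 1"
  shows "coprime m (2 ^ i * q ^ s * r ^ t) \<longleftrightarrow> \<not> (q dvd m \<or> r dvd m)"
proof -
  have "coprime m x \<longleftrightarrow> \<not> x dvd m" if "prime x" for x :: int
    using that by (metis coprime_absorb_left coprime_commute not_prime_unit prime_imp_coprime)
  then show ?thesis
    using assms by simp
qed

section \<open>Powers of a generator, in general and modulo an odd prime\<close>

lemma (in group) generate_int_pow_eq_carrier_iff: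
  fixes k :: int
  assumes g: "g \<in> carrier G" and gen: "generate G {g} = carrier G"
  shows "generate G {g [^] k} = carrier G \<longleftrightarrow> coprime k (int (ord g))"
proof -
  have gk: "g [^] k \<in> carrier G"
    using g by simp
  \<comment> \<open>It suffices to recover \<open>g\<close> from its power, which amounts to
    inverting \<open>k\<close> modulo the order. For infinite order, \<open>ord g\<close> is 0 and
    the congruence is equality.\<close>
  have "generate G {g [^] k} = carrier G \<longleftrightarrow> g \<in> generate G {g [^] k}"
  proof
    assume "g \<in> generate G {g [^] k}"
    then have "generate G {g} \<subseteq> generate G {g [^] k}"
      using generate_subgroup_incl[of "{g}"] generate_is_subgroup[of "{g [^] k}"] gk by simp
    then show "generate G {g [^] k} = carrier G"
      using gen generate_incl[of "{g [^] k}"] gk by auto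
  qed (use g in simp)
  also have "\<dots> \<longleftrightarrow> (\<exists>l::int. g [^] (1::int) = g [^] (k * l))"
    using g by (auto simp: generate_pow[OF gk] int_pow_pow)
  also have "\<dots> \<longleftrightarrow> (\<exists>l. [k * l = 1] (mod int (ord g)))"
    by (simp add: int_pow_eq[OF g] cong_iff_dvd_diff)
  also have "\<dots> \<longleftrightarrow> coprime k (int (ord g))"
    by (simp add: coprime_iff_invertible_int)
  finally show ?thesis .
qed

context
  fixes p :: nat and g :: int
  assumes p: "prime p" and odd_p: "odd p" and g: "g \<in> gens p"
begin

interpretation R: residues_prime p "residue_ring (int p)"
  by unfold_locales (rule p)

interpretation Z: comm_group "Zstar p"
  unfolding Zstar_def by (rule R.units_comm_group)

private lemma carrier_Zstar: "carrier (Zstar p) = {1..int p - 1}"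
  using prime_gt_0_nat[OF p]
  by (simp add: Zstar_def units_of_carrier R.res_prime_units_eq of_nat_diff)

private lemma mult_Zstar: "x \<otimes>\<^bsub>Zstar p\<^esub> y = x * y mod int p"
  by (simp add: Zstar_def units_of_mult R.res_mult_eq)

private lemma g_carrier: "g \<in> carrier (Zstar p)"
  and g_generates: "generate (Zstar p) {g} = carrier (Zstar p)"
  using g by (simp_all add: gens_def)

private lemma ord_generator: "int (Z.ord g) = int p - 1"
  using Z.generate_pow_card[OF g_carrier] g_generates carrier_Zstar prime_gt_0_nat[OF p] by simp

private lemma ex_pow_generator: "x \<in> carrier (Zstar p) \<Longrightarrow> \<exists>k::int. x = g [^]\<^bsub>Zstar p\<^esub> k"
  using Z.generate_pow[OF g_carrier] g_generates by auto

private lemma pow_in_gens_iff: "g [^]\<^bsub>Zstar p\<^esub> (k::int) \<in> gens p \<longleftrightarrow> coprime k (int p - 1)"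
  using Z.generate_int_pow_eq_carrier_iff[OF g_carrier g_generates, of k] g_carrier
  by (simp add: gens_def ord_generator)

private lemma pow_in_quad_res_iff: "g [^]\<^bsub>Zstar p\<^esub> (k::int) \<in> quad_res p \<longleftrightarrow> even k"
proof -
  let ?x = "g [^]\<^bsub>Zstar p\<^esub> k"
  have x: "?x \<in> carrier (Zstar p)"
    using g_carrier by simp
  have "?x \<in> quad_res p \<longleftrightarrow> (\<exists>y \<in> carrier (Zstar p). y \<otimes>\<^bsub>Zstar p\<^esub> y = ?x)"
  proof
    assume "?x \<in> quad_res p"
    then obtain y where y: "[y\<^sup>2 = ?x] (mod int p)"
      by (auto simp: quad_res_def QuadRes_def)
    \<comment> \<open>\<open>QuadRes\<close> allows any integer root, so it is reduced to a
      representative; this is nonzero because \<open>?x\<close> is a unit.\<close>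
    have sq: "(y mod int p) * (y mod int p) mod int p = ?x"
      using y x carrier_Zstar by (simp add: cong_def power2_eq_square mod_mult_eq)
    have "y mod int p \<noteq> 0"
      using sq x carrier_Zstar by auto
    then have "y mod int p \<in> carrier (Zstar p)"
      using pos_mod_bound[of "int p" y] pos_mod_sign[of "int p" y] prime_gt_0_nat[OF p]
      unfolding carrier_Zstar atLeastAtMost_iff by linarith
    then show "\<exists>y \<in> carrier (Zstar p). y \<otimes>\<^bsub>Zstar p\<^esub> y = ?x"
      using sq by (auto simp: mult_Zstar)
  next
    assume "\<exists>y \<in> carrier (Zstar p). y \<otimes>\<^bsub>Zstar p\<^esub> y = ?x"
    then obtain y where "y * y mod int p = ?x"
      by (auto simp: mult_Zstar)
    then have "[y\<^sup>2 = ?x] (mod int p)"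
      by (metis cong_mod_left cong_refl power2_eq_square cong_sym)
    then show "?x \<in> quad_res p"
      using x by (auto simp: quad_res_def QuadRes_def)
  qed
  also have "\<dots> \<longleftrightarrow> (\<exists>l::int. g [^]\<^bsub>Zstar p\<^esub> (2 * l) = ?x)"
    (is "_ \<longleftrightarrow> ?squares")
  proof -
    have double: "g [^]\<^bsub>Zstar p\<^esub> l \<otimes>\<^bsub>Zstar p\<^esub> g [^]\<^bsub>Zstar p\<^esub> l = g [^]\<^bsub>Zstar p\<^esub> (2 * l)" for l :: int
      by (simp add: Z.int_pow_mult[OF g_carrier, symmetric])
    show ?thesis
    proof
      assume "\<exists>y \<in> carrier (Zstar p). y \<otimes>\<^bsub>Zstar p\<^esub> y = ?x"
      then obtain y where y: "y \<in> carrier (Zstar p)" "y \<otimes>\<^bsub>Zstar p\<^esub> y = ?x"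
        by blast
      then show ?squares
        using ex_pow_generator[OF y(1)] double by auto
    next
      assume ?squares
      then obtain l :: int where "g [^]\<^bsub>Zstar p\<^esub> (2 * l) = ?x"
        by blast
      then show "\<exists>y \<in> carrier (Zstar p). y \<otimes>\<^bsub>Zstar p\<^esub> y = ?x"
        using double[of l] Z.int_pow_closed[OF g_carrier, of l] by auto
    qed
  qed
  also have "\<dots> \<longleftrightarrow> (\<exists>l. int p - 1 dvd k - 2 * l)"
    by (simp add: Z.int_pow_eq[OF g_carrier] ord_generator)
  also have "\<dots> \<longleftrightarrow> even k"
  proof
    assume "\<exists>l. int p - 1 dvd k - 2 * l"
    then obtain l where "int p - 1 dvd k - 2 * l" ..
    \<comment> \<open>Exponents matter only modulo \<open>p - 1\<close>, whose evenness makes their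
      parity well defined.\<close>
    moreover have "2 dvd int p - 1"
      using odd_p by simp
    ultimately have "2 dvd k - 2 * l"
      by (rule dvd_trans[rotated])
    then show "even k"
      by simp
  next
    assume "even k"
    then have "int p - 1 dvd k - 2 * (k div 2)"
      by simp
    then show "\<exists>l. int p - 1 dvd k - 2 * l" ..
  qed
  finally show ?thesis .
qed

text \<open>For even \<open>k\<close> the exponent \<open>a + k\<close> is odd, so the product is
  automatically a non-residue and only failing to generate is a condition.\<close>

private lemma pow_in_Rbar_iff:
  fixes a k :: int
  assumes "odd a"
  shows "g [^]\<^bsub>Zstar p\<^esub> k \<in> Rbar p (g [^]\<^bsub>Zstar p\<^esub> a) \<longleftrightarrow> even k \<and> \<not> coprime (a + k) (int p - 1)"
  using assms pow_in_quad_res_iff[of "a + k"] pow_in_gens_iff[of "a + k"] g_carrier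
  by (auto simp: Rbar_def nonres_nongens_def pow_in_quad_res_iff Z.int_pow_mult[symmetric])

lemma pow_in_NI_iff:
  fixes a k :: int
  assumes "odd a"
  shows "g [^]\<^bsub>Zstar p\<^esub> k \<in> NI p (g [^]\<^bsub>Zstar p\<^esub> a) \<longleftrightarrow>
    even k \<and> \<not> coprime (k + a) (int p - 1) \<and> \<not> coprime (k - a) (int p - 1)"
  using assms pow_in_Rbar_iff[of a k] pow_in_Rbar_iff[of "- a" k]
  by (auto simp: NI_def Z.int_pow_neg[OF g_carrier] add.commute)

lemma ex_coprime_exponent:
  assumes "h \<in> gens p"
  shows "\<exists>a::int. h = g [^]\<^bsub>Zstar p\<^esub> a \<and> coprime a (int p - 1)"
  using assms ex_pow_generator[of h] pow_in_gens_iff by (auto simp: gens_def)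

lemma NI_subset_powers: "NI p h \<subseteq> range (\<lambda>k::int. g [^]\<^bsub>Zstar p\<^esub> k)"
  using ex_pow_generator by (fastforce simp: NI_def Rbar_def quad_res_def)

end

section \<open>Comparing \<open>NI\<close> for two generators\<close>

theorem theorem4p1:
  fixes p q\<^sub>1 q\<^sub>2 i j\<^sub>1 j\<^sub>2 :: nat and g\<^sub>1 g\<^sub>2 :: int
  assumes "prime p"
    and "prime q\<^sub>1" and "odd q\<^sub>1" and "prime q\<^sub>2" and "odd q\<^sub>2" and "q\<^sub>1 \<noteq> q\<^sub>2"
    and "i \<ge> 1" and "j\<^sub>1 \<ge> 1" and "j\<^sub>2 \<ge> 1"
    and "p - 1 = 2 ^ i * q\<^sub>1 ^ j\<^sub>1 * q\<^sub>2 ^ j\<^sub>2"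
    and "g\<^sub>1 \<in> gens p" and "g\<^sub>2 \<in> gens p"
  shows "(NI p g\<^sub>1 \<inter> NI p g\<^sub>2 = {} \<or> NI p g\<^sub>1 = NI p g\<^sub>2) \<and>
         \<not> (NI p g\<^sub>1 \<inter> NI p g\<^sub>2 = {} \<and> NI p g\<^sub>1 = NI p g\<^sub>2)"
proof -
  let ?q = "int q\<^sub>1" and ?r = "int q\<^sub>2"
  let ?pow = "\<lambda>k::int. g\<^sub>1 [^]\<^bsub>Zstar p\<^esub> k"
  have n: "int p - 1 = 2 ^ i * ?q ^ j\<^sub>1 * ?r ^ j\<^sub>2"
    using arg_cong[OF assms(10), of int] prime_gt_0_nat[OF assms(1)] by (simp add: of_nat_diff)
  have "even (int p - 1)"
    using n assms(7) by simp
  then have odd_p: "odd p"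
    by simp
  note NI_iff = pow_in_NI_iff[OF assms(1) odd_p assms(11)]
  have qr: "prime ?q" "prime ?r" "odd ?q" "odd ?r"
    using assms(2-5) by simp_all
  have NI_pow: "?pow k \<in> NI p (?pow a) \<longleftrightarrow> even k \<and> opposite_cong ?q ?r a k"
    if a: "coprime a (int p - 1)" for a k
  proof -
    have "odd a"
      using a \<open>even (int p - 1)\<close> coprime_common_divisor[of a "int p - 1" 2] by auto
    have "coprime a ?q" "coprime a ?r"
      using a assms(8,9) unfolding n by simp_all
    moreover have "odd (k + a)" "odd (k - a)" if "even k"
      using \<open>odd a\<close> that by simp_all
    ultimately show ?thesis
      using NI_iff[OF \<open>odd a\<close>, of k, unfolded n] opposite_cong_iff[OF qr, of a k]
        odd_coprime_iff_not_dvd[OF qr(1,2) _ assms(8,9), of "k + a" i]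
        odd_coprime_iff_not_dvd[OF qr(1,2) _ assms(8,9), of "k - a" i]
      by blast
  qed
  \<comment> \<open>Writing \<open>g\<^sub>1\<close> as a power of itself lets both generators be
    treated alike over one base.\<close>
  obtain a where a: "g\<^sub>1 = ?pow a" "coprime a (int p - 1)"
    using ex_coprime_exponent[OF assms(1) odd_p assms(11,11)] by blast
  obtain b where b: "g\<^sub>2 = ?pow b" "coprime b (int p - 1)"
    using ex_coprime_exponent[OF assms(1) odd_p assms(11,12)] by blast
  have NI_eq: "NI p h = ?pow ` {k. even k \<and> opposite_cong ?q ?r c k}"
    if "h = ?pow c" "coprime c (int p - 1)" for h c
  proof -
    have "NI p h \<subseteq> range ?pow"
      by (rule NI_subset_powers[OF assms(1) odd_p assms(11)])
    then show ?thesis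
      using NI_pow[OF that(2)] that(1) by auto
  qed
  have "NI p g\<^sub>1 = NI p g\<^sub>2" if common: "NI p g\<^sub>1 \<inter> NI p g\<^sub>2 \<noteq> {}"
  proof -
    obtain x where x: "x \<in> NI p g\<^sub>1" "x \<in> NI p g\<^sub>2"
      using common by blast
    obtain k where "x = ?pow k"
      using x(1) NI_eq[OF a] by blast
    then have "opposite_cong ?q ?r a k" "opposite_cong ?q ?r b k"
      using x NI_pow[OF a(2), of k] NI_pow[OF b(2), of k] a(1) b(1) by auto
    then have "opposite_cong ?q ?r a l \<longleftrightarrow> opposite_cong ?q ?r b l" for l
      by (intro opposite_cong_transfer opposite_cong_common)
    then show ?thesis
      using NI_eq[OF a] NI_eq[OF b] by simp
  qed
  \<comment> \<open>Sets that are both equal and disjoint would be empty, so nonemptiness makes the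
    alternatives exclusive.\<close>
  moreover have "NI p g\<^sub>1 \<noteq> {}"
  proof -
    have "coprime ?q ?r"
      using assms(2,4,6) by (simp add: primes_coprime)
    then show ?thesis
      using ex_even_opposite_cong[OF _ qr(3,4), of a] NI_eq[OF a] by auto
  qed
  ultimately show ?thesis
    by auto
qed

end
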